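(* Let $G$ and $H$ be $(z,w)$-colored rooted graphs whose root vertices have the same color $a_{11}\in\{z,w\}$. Let $0$ denote the graph consisting of a single vertex with color $a_{11}$. Let $G\star H$ be the star product of $G$ and $H$. Then, with all representing functions computed at the root vertex, $$g_{G\star H}(z,w) = g_G(z,w) + g_H(z,w) - g_0(z,w).$$
   Context: Let $\Pi=\{z\in\mathbb{C}:\operatorname{Im} z>0\}$; $(z,w)\in\Pi^2$. Graphs are finite, simple and undirected. A $(z,w)$-colored graph is such a graph $G$ with each vertex labelled (colored) by one of the two variables $z$ or $w$. Its colored adjacency matrix is $\mathcal{A}_G = A_G - D$, where $A_G$ is the usual $0/1$ adjacency matrix and $D$ is the diagonal matrix whose $k$-th diagonal entry is the color ($z$ or $w$) of vertex $k$ (i.e. each vertex gets a self-loop with weight the negative of its color). The representing function (Nevanlinna representation) of $G$ with respect to vertex $k$ is $f_G^k(z,w) = (\mathcal{A}_G^{-1})_{(k,k)}$, the $(k,k)$ entry of the inverse matrix. When $k$ is the root vertex we write $f_G$, and we put $g_G(z,w) = 1/f_G(z,w)$. The star product $G\star H$ of two rooted graphs is the rooted graph obtained from the disjoint union of $G$ and $H$ by identifying their two roots to a single vertex (the root of $G\star H$), which keeps the shared color; all other vertices keep their colors. *)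

theory Defs
  imports Complex_Main "Jordan_Normal_Form.Gauss_Jordan_Elimination" "Jordan_Normal_Form.Determinant"
begin

datatype color = Color_z | Color_w

fun color_val :: "color \<Rightarrow> complex \<Rightarrow> complex \<Rightarrow> complex" where
  "color_val Color_z z w = z"
| "color_val Color_w z w = w"

record 'a rcgraph =
  verts :: "'a set"
  edges :: "'a set set"
  color :: "'a \<Rightarrow> color"
  root_vertex :: 'a

text \<open>Edges are two-element sets of vertices, so the graph is undirected, without loops and
  without multiple edges. Colors outside \<open>verts G\<close> are irrelevant.\<close>

locale rooted_colored_graph =
  fixes G :: "'a rcgraph"
  assumes finite_verts: "finite (verts G)"
    and edges_wf: "edges G \<subseteq> {e. e \<subseteq> verts G \<and> card e = 2}"
    and root_in_verts: "root_vertex G \<in> verts G"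

text \<open>Matrices have natural number indices, so an enumeration of the vertices is fixed. Another
  enumeration conjugates the matrices below by a permutation matrix, which does not change the
  diagonal entry of the inverse belonging to a given vertex.\<close>

definition vertex_list :: "'a rcgraph \<Rightarrow> 'a list" where
  "vertex_list G = (SOME vs. distinct vs \<and> set vs = verts G)"

definition vertex_index :: "'a rcgraph \<Rightarrow> 'a \<Rightarrow> nat" where
  "vertex_index G v = (THE i. i < length (vertex_list G) \<and> vertex_list G ! i = v)"

definition adjacency_mat :: "'a rcgraph \<Rightarrow> complex mat" where
  "adjacency_mat G = mat (card (verts G)) (card (verts G))
     (\<lambda>(i, j). if {vertex_list G ! i, vertex_list G ! j} \<in> edges G then 1 else 0)"

definition colored_adjacency_mat :: "'a rcgraph \<Rightarrow> complex \<Rightarrow> complex \<Rightarrow> complex mat" where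
  "colored_adjacency_mat G z w = adjacency_mat G
     - mat_diag (card (verts G)) (\<lambda>k. color_val (color G (vertex_list G ! k)) z w)"

text \<open>The three functions below are \<open>f_G^k\<close>, \<open>f_G\<close> and \<open>g_G\<close>.
  For \<open>z\<close> and \<open>w\<close> in the upper half plane the inverse exists and its diagonal entries are
  nonzero, see \<open>mat_inverse_colored_adjacency_mat\<close> and
  \<open>representing_fun_nonzero\<close>.\<close>

definition representing_fun :: "'a rcgraph \<Rightarrow> 'a \<Rightarrow> complex \<Rightarrow> complex \<Rightarrow> complex" where
  "representing_fun G k z w =
     the (mat_inverse (colored_adjacency_mat G z w)) $$ (vertex_index G k, vertex_index G k)"

definition root_fun :: "'a rcgraph \<Rightarrow> complex \<Rightarrow> complex \<Rightarrow> complex" where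
  "root_fun G z w = representing_fun G (root_vertex G) z w"

definition recip_root_fun :: "'a rcgraph \<Rightarrow> complex \<Rightarrow> complex \<Rightarrow> complex" where
  "recip_root_fun G z w = 1 / root_fun G z w"

definition single_vertex_graph :: "color \<Rightarrow> unit rcgraph" where
  "single_vertex_graph c = \<lparr>verts = {()}, edges = {}, color = (\<lambda>_. c), root_vertex = ()\<rparr>"

text \<open>The star product lives on the disjoint sum of the vertex types. The identified root is
  represented by \<open>Inl (root_vertex G)\<close>; the map \<open>star_inr\<close> embeds \<open>H\<close>, sending its root there.
  The identified root takes the color of the root of \<open>G\<close>, so the definition is only meaningful
  if both roots have the same color.\<close>

definition star_inr :: "'a rcgraph \<Rightarrow> 'b rcgraph \<Rightarrow> 'b \<Rightarrow> 'a + 'b" where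
  "star_inr G H v = (if v = root_vertex H then Inl (root_vertex G) else Inr v)"

definition star_product :: "'a rcgraph \<Rightarrow> 'b rcgraph \<Rightarrow> ('a + 'b) rcgraph"
    (infixl "\<star>" 65) where
  "G \<star> H = \<lparr>verts = Inl ` verts G \<union> star_inr G H ` verts H,
     edges = image Inl ` edges G \<union> image (star_inr G H) ` edges H,
     color = case_sum (color G) (color H),
     root_vertex = Inl (root_vertex G)\<rparr>"

lemma rooted_colored_graph_single_vertex: "rooted_colored_graph (single_vertex_graph c)"
  by unfold_locales (auto simp: single_vertex_graph_def)

lemma inj_star_inr: "inj (star_inr G H)"
  by (auto simp: inj_def star_inr_def split: if_splits)

lemma rooted_colored_graph_star:
  assumes "rooted_colored_graph G" and "rooted_colored_graph H"
  shows "rooted_colored_graph (G \<star> H)"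
proof -
  interpret G: rooted_colored_graph G by fact
  interpret H: rooted_colored_graph H by fact
  let ?V = "Inl ` verts G \<union> star_inr G H ` verts H"
  have "image Inl ` edges G \<union> image (star_inr G H) ` edges H \<subseteq> {e. e \<subseteq> ?V \<and> card e = 2}"
  proof
    fix e' assume "e' \<in> image Inl ` edges G \<union> image (star_inr G H) ` edges H"
    then show "e' \<in> {e. e \<subseteq> ?V \<and> card e = 2}"
    proof
      assume "e' \<in> image Inl ` edges G"
      then obtain e where e: "e \<in> edges G" "e' = Inl ` e" by blast
      then have "e \<subseteq> verts G" "card e = 2" using G.edges_wf by blast+
      moreover have "card e' = card e" unfolding e(2) by (simp add: card_image)
      ultimately show ?thesis unfolding e(2) by auto
    next
      assume "e' \<in> image (star_inr G H) ` edges H"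
      then obtain e where e: "e \<in> edges H" "e' = star_inr G H ` e" by blast
      then have "e \<subseteq> verts H" "card e = 2" using H.edges_wf by blast+
      moreover have "card e' = card e"
        unfolding e(2) by (rule card_image[OF inj_on_subset[OF inj_star_inr subset_UNIV]])
      ultimately show ?thesis unfolding e(2) by auto
    qed
  qed
  then show ?thesis
    using G.finite_verts H.finite_verts G.root_in_verts
    by unfold_locales (simp_all add: star_product_def)
qed

context rooted_colored_graph
begin

lemma vertex_list: "distinct (vertex_list G)" "set (vertex_list G) = verts G"
  using someI_ex[of "\<lambda>vs. distinct vs \<and> set vs = verts G"] finite_distinct_list[OF finite_verts]
  unfolding vertex_list_def by blast+

lemma length_vertex_list: "length (vertex_list G) = card (verts G)"
  using vertex_list distinct_card by fastforce

lemma vertex_index: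
  assumes "v \<in> verts G"
  shows "vertex_index G v < card (verts G)" "vertex_list G ! vertex_index G v = v"
proof -
  have "\<exists>!i. i < length (vertex_list G) \<and> vertex_list G ! i = v"
    using assms vertex_list by (metis distinct_Ex1)
  from theI'[OF this]
  show "vertex_index G v < card (verts G)" "vertex_list G ! vertex_index G v = v"
    by (auto simp: vertex_index_def length_vertex_list)
qed

lemma colored_adjacency_mat_carrier:
  "colored_adjacency_mat G z w \<in> carrier_mat (card (verts G)) (card (verts G))"
  by (auto simp: colored_adjacency_mat_def adjacency_mat_def mat_diag_def)

lemma colored_adjacency_mat_index:
  assumes "i < card (verts G)" "j < card (verts G)"
  shows "colored_adjacency_mat G z w $$ (i, j) =
    (if {vertex_list G ! i, vertex_list G ! j} \<in> edges G then 1 else 0)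
    - (if i = j then color_val (color G (vertex_list G ! i)) z w else 0)"
  using assms by (auto simp: colored_adjacency_mat_def adjacency_mat_def mat_diag_def)

lemma eq_zero_if_Im_quadratic_form_zero:
  fixes x :: "nat \<Rightarrow> complex"
  assumes z: "Im z > 0" and w: "Im w > 0"
    and q: "Im (\<Sum>i<card (verts G). cnj (x i) *
      (\<Sum>j<card (verts G). colored_adjacency_mat G z w $$ (i, j) * x j)) = 0"
    and k: "k < card (verts G)"
  shows "x k = 0"
proof -
  let ?n = "card (verts G)"
  define a :: "nat \<Rightarrow> nat \<Rightarrow> complex" where
    "a = (\<lambda>i j. if {vertex_list G ! i, vertex_list G ! j} \<in> edges G then 1 else 0)"
  define c where "c = (\<lambda>i. color_val (color G (vertex_list G ! i)) z w)"
  have c_pos: "Im (c i) > 0" for i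
    unfolding c_def using z w by (cases "color G (vertex_list G ! i)") auto
  define S where "S = (\<Sum>i<?n. \<Sum>j<?n. cnj (x i) * a i j * x j)"
  have "cnj S = (\<Sum>i<?n. \<Sum>j<?n. cnj (x j) * a j i * x i)"
  proof -
    have "cnj (cnj (x i) * a i j * x j) = cnj (x j) * a j i * x i" for i j
      by (simp add: a_def insert_commute mult_ac)
    then show ?thesis unfolding S_def cnj_sum by (simp only:)
  qed
  also have "\<dots> = S" unfolding S_def by (rule sum.swap)
  finally have S: "Im S = 0" by (metis Reals_cnj_iff complex_is_Real_iff)
  have "(\<Sum>i<?n. cnj (x i) * (\<Sum>j<?n. colored_adjacency_mat G z w $$ (i, j) * x j))
      = (\<Sum>i<?n. cnj (x i) * ((\<Sum>j<?n. a i j * x j) - c i * x i))"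
  proof (rule sum.cong[OF refl])
    fix i assume i: "i \<in> {..<?n}"
    have "(\<Sum>j<?n. colored_adjacency_mat G z w $$ (i, j) * x j)
        = (\<Sum>j<?n. a i j * x j - (if i = j then c i * x j else 0))"
      using i by (intro sum.cong[OF refl])
        (auto simp: colored_adjacency_mat_index a_def c_def algebra_simps)
    also have "\<dots> = (\<Sum>j<?n. a i j * x j) - c i * x i"
      using i by (simp add: sum_subtractf sum.delta)
    finally show "cnj (x i) * (\<Sum>j<?n. colored_adjacency_mat G z w $$ (i, j) * x j)
        = cnj (x i) * ((\<Sum>j<?n. a i j * x j) - c i * x i)" by simp
  qed
  also have "\<dots> = S - (\<Sum>i<?n. c i * of_real ((cmod (x i))\<^sup>2))"
    unfolding S_def complex_norm_square
    by (simp add: sum_subtractf right_diff_distrib sum_distrib_left mult_ac)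
  finally have "(\<Sum>i<?n. Im (c i) * (cmod (x i))\<^sup>2) = 0"
    using q S by simp
  then have "\<forall>i\<in>{..<?n}. Im (c i) * (cmod (x i))\<^sup>2 = 0"
    using c_pos by (subst (asm) sum_nonneg_eq_0_iff) (auto simp: less_imp_le)
  with k have "Im (c k) * (cmod (x k))\<^sup>2 = 0" by blast
  with c_pos[of k] show ?thesis by simp
qed

lemma mat_inverse_colored_adjacency_mat:
  assumes "Im z > 0" and "Im w > 0"
  obtains B where "mat_inverse (colored_adjacency_mat G z w) = Some B"
    "B \<in> carrier_mat (card (verts G)) (card (verts G))"
    "colored_adjacency_mat G z w * B = 1\<^sub>m (card (verts G))"
    "B * colored_adjacency_mat G z w = 1\<^sub>m (card (verts G))"
proof -
  let ?n = "card (verts G)" and ?A = "colored_adjacency_mat G z w"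
  note A = colored_adjacency_mat_carrier[of z w]
  have "det ?A \<noteq> 0"
  proof
    assume "det ?A = 0"
    then obtain v where v: "v \<in> carrier_vec ?n" "v \<noteq> 0\<^sub>v ?n" "?A *\<^sub>v v = 0\<^sub>v ?n"
      using det_0_iff_vec_prod_zero[OF A] by blast
    have "(\<Sum>j<?n. ?A $$ (i, j) * v $ j) = 0" if "i < ?n" for i
    proof -
      have "(?A *\<^sub>v v) $ i = (\<Sum>j<?n. ?A $$ (i, j) * v $ j)"
        using A v(1) that by (simp add: scalar_prod_def lessThan_atLeast0)
      then show ?thesis using v(3) that by simp
    qed
    then have "Im (\<Sum>i<?n. cnj (v $ i) * (\<Sum>j<?n. ?A $$ (i, j) * v $ j)) = 0" by simp
    from eq_zero_if_Im_quadratic_form_zero[OF assms this] v(1)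
    have "v = 0\<^sub>v ?n" by (intro eq_vecI) auto
    with v(2) show False by simp
  qed
  from det_non_zero_imp_unit[OF A this, of "()"] mat_inverse(1)[OF A, of "()"]
  obtain B where "mat_inverse ?A = Some B" by fastforce
  with mat_inverse(2)[OF A this] that show thesis by blast
qed

lemma representing_fun_nonzero:
  assumes "Im z > 0" and "Im w > 0" and "k \<in> verts G"
  shows "representing_fun G k z w \<noteq> 0"
proof
  let ?n = "card (verts G)" and ?A = "colored_adjacency_mat G z w" and ?k = "vertex_index G k"
  assume f0: "representing_fun G k z w = 0"
  note A = colored_adjacency_mat_carrier[of z w] and k = vertex_index(1)[OF assms(3)]
  obtain B where B: "mat_inverse ?A = Some B" "B \<in> carrier_mat ?n ?n" "?A * B = 1\<^sub>m ?n"
    using mat_inverse_colored_adjacency_mat[OF assms(1,2)] by blast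
  have Bk: "B $$ (?k, ?k) = 0" using f0 B(1) by (simp add: representing_fun_def)
  have AB: "(\<Sum>j<?n. ?A $$ (i, j) * B $$ (j, ?k)) = (if i = ?k then 1 else 0)" if "i < ?n" for i
  proof -
    have "(?A * B) $$ (i, ?k) = (\<Sum>j<?n. ?A $$ (i, j) * B $$ (j, ?k))"
      using A B(2) that k by (simp add: scalar_prod_def lessThan_atLeast0)
    then show ?thesis using B(3) that k by simp
  qed
  have "(\<Sum>i<?n. cnj (B $$ (i, ?k)) * (\<Sum>j<?n. ?A $$ (i, j) * B $$ (j, ?k))) = 0"
    using AB Bk by (intro sum.neutral) auto
  then have "Im (\<Sum>i<?n. cnj (B $$ (i, ?k)) * (\<Sum>j<?n. ?A $$ (i, j) * B $$ (j, ?k))) = 0" by simp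
  from eq_zero_if_Im_quadratic_form_zero[OF assms(1,2) this]
  have "(\<Sum>j<?n. ?A $$ (?k, j) * B $$ (j, ?k)) = 0" by simp
  with AB[OF k] show False by simp
qed

end

end

(* The reciprocal g_G is the value at the root of A x, where A is the colored adjacency matrix and
   x is the unique function with x = 1 at the root and A x = 0 at all other vertices. Such solutions
   for G and H agree at the identified root, so they glue to a solution for the star product. The
   value of A x at the root is the sum of the two values, except that the diagonal entry g_0 of the
   root has been counted twice. *)

theory Submission
  imports Defs
begin

section \<open>The adjacency operator on functions\<close>

definition neighbours :: "'a rcgraph \<Rightarrow> 'a \<Rightarrow> 'a set" where
  "neighbours G u = {v. {u, v} \<in> edges G}"

text \<open>The colored adjacency matrix as an operator on functions of vertices. No enumeration of
  the vertices enters, so functions on \<open>G\<close> and \<open>H\<close> can be glued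
  directly.\<close>

definition colored_adjacency_op ::
    "'a rcgraph \<Rightarrow> complex \<Rightarrow> complex \<Rightarrow> ('a \<Rightarrow> complex) \<Rightarrow> 'a \<Rightarrow> complex" where
  "colored_adjacency_op G z w x u = sum x (neighbours G u) - color_val (color G u) z w * x u"

text \<open>An injective \<open>f\<close> is also injective on sets, so an edge is recovered from
  its image. Both edge sets of the star product have this form, with \<open>Inl\<close> and
  \<open>star_inr G H\<close> as \<open>f\<close>.\<close>

lemma doubleton_in_image_image_iff:
  assumes "inj f"
  shows "{f a, v} \<in> image f ` E \<longleftrightarrow> v \<in> f ` {b. {a, b} \<in> E}"
proof
  assume "{f a, v} \<in> image f ` E"
  then obtain e where e: "e \<in> E" "f ` e = {f a, v}" by force
  from e(2) obtain b where b: "v = f b" by blast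
  have "f ` e = f ` {a, b}" using e(2) b by simp
  then have "e = {a, b}" by (rule iffD1[OF inj_image_eq_iff[OF assms]])
  with e(1) b show "v \<in> f ` {b. {a, b} \<in> E}" by blast
next
  assume "v \<in> f ` {b. {a, b} \<in> E}"
  then obtain b where "{a, b} \<in> E" "v = f b" by blast
  then show "{f a, v} \<in> image f ` E" by (intro image_eqI[of _ _ "{a, b}"]) auto
qed

section \<open>Neighbourhoods in the star product\<close>

lemma root_vertex_star: "root_vertex (G \<star> H) = Inl (root_vertex G)"
  and color_star: "color (G \<star> H) = case_sum (color G) (color H)"
  and verts_star: "verts (G \<star> H) = Inl ` verts G \<union> star_inr G H ` verts H"
  by (simp_all add: star_product_def)

text \<open>The only value of \<open>star_inr G H\<close> in the left summand is the identified
  root, so no edge coming from \<open>H\<close> meets another left vertex.\<close>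

lemma neighbours_star_Inl:
  assumes "u \<noteq> root_vertex G"
  shows "neighbours (G \<star> H) (Inl u) = Inl ` neighbours G u"
proof -
  have "{Inl u, v} \<notin> image (star_inr G H) ` edges H" for v
  proof
    assume "{Inl u, v} \<in> image (star_inr G H) ` edges H"
    then have "Inl u \<in> range (star_inr G H)" by blast
    with assms show False by (auto simp: star_inr_def split: if_splits)
  qed
  then show ?thesis
    unfolding neighbours_def
    by (auto simp: star_product_def doubleton_in_image_image_iff)
qed

lemma neighbours_star_Inr:
  assumes "u \<noteq> root_vertex H"
  shows "neighbours (G \<star> H) (Inr u) = star_inr G H ` neighbours H u"
proof -
  have u: "Inr u = star_inr G H u" using assms by (simp add: star_inr_def)
  have "{Inr u, v} \<notin> image Inl ` edges G" for v by blast
  moreover have "{Inr u, v} \<in> image (star_inr G H) ` edges H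
      \<longleftrightarrow> v \<in> star_inr G H ` neighbours H u" for v
    unfolding u neighbours_def by (rule doubleton_in_image_image_iff[OF inj_star_inr])
  ultimately show ?thesis
    unfolding neighbours_def[of "G \<star> H"] by (simp add: star_product_def)
qed

lemma neighbours_star_root:
  "neighbours (G \<star> H) (Inl (root_vertex G)) =
    Inl ` neighbours G (root_vertex G) \<union> star_inr G H ` neighbours H (root_vertex H)"
proof -
  \<comment> \<open>The identified root lies in the range of both embeddings, so edges from both
    graphs contribute.\<close>
  have r: "Inl (root_vertex G) = star_inr G H (root_vertex H)" by (simp add: star_inr_def)
  have "{Inl (root_vertex G), v} \<in> image Inl ` edges G
      \<longleftrightarrow> v \<in> Inl ` neighbours G (root_vertex G)" for v :: "'a + 'b"
    unfolding neighbours_def by (rule doubleton_in_image_image_iff) simp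
  moreover have "{Inl (root_vertex G), v} \<in> image (star_inr G H) ` edges H
      \<longleftrightarrow> v \<in> star_inr G H ` neighbours H (root_vertex H)" for v
    unfolding r neighbours_def by (rule doubleton_in_image_image_iff[OF inj_star_inr])
  ultimately show ?thesis
    unfolding neighbours_def[of "G \<star> H"] by (auto simp: star_product_def)
qed

section \<open>Linear systems and the reciprocal at the root\<close>

context rooted_colored_graph
begin

lemma neighbours_subset: "neighbours G u \<subseteq> verts G"
  using edges_wf by (auto simp: neighbours_def)

lemma finite_neighbours: "finite (neighbours G u)"
  using neighbours_subset finite_verts by (rule finite_subset)

lemma not_in_neighbours: "u \<notin> neighbours G u"
  using edges_wf by (auto simp: neighbours_def)

text \<open>The bridge from matrices to the operator: the enumeration is a bijection onto the
  vertices, so the sum over column indices becomes a sum over vertices, and only neighbours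
  contribute besides the diagonal.\<close>

lemma colored_adjacency_mat_mult_vec:
  "colored_adjacency_mat G z w *\<^sub>v vec (card (verts G)) (\<lambda>j. x (vertex_list G ! j))
    = vec (card (verts G)) (\<lambda>i. colored_adjacency_op G z w x (vertex_list G ! i))"
proof (intro eq_vecI)
  let ?n = "card (verts G)" and ?A = "colored_adjacency_mat G z w"
  note A = colored_adjacency_mat_carrier[of z w]
  fix i assume "i < dim_vec (vec ?n (\<lambda>i. colored_adjacency_op G z w x (vertex_list G ! i)))"
  then have i: "i < ?n" by simp
  let ?u = "vertex_list G ! i"
  have bij: "bij_betw ((!) (vertex_list G)) {..<?n} (verts G)"
    by (rule bij_betw_nth) (simp_all add: vertex_list length_vertex_list)
  have "(?A *\<^sub>v vec ?n (\<lambda>j. x (vertex_list G ! j))) $ i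
      = (\<Sum>j<?n. ?A $$ (i, j) * x (vertex_list G ! j))"
    using A i by (simp add: scalar_prod_def lessThan_atLeast0)
  also have "\<dots> = (\<Sum>j<?n. (if {?u, vertex_list G ! j} \<in> edges G then x (vertex_list G ! j) else 0)
      - (if i = j then color_val (color G ?u) z w * x ?u else 0))"
    using i by (intro sum.cong[OF refl]) (auto simp: colored_adjacency_mat_index algebra_simps)
  also have "\<dots> = (\<Sum>j<?n. if {?u, vertex_list G ! j} \<in> edges G then x (vertex_list G ! j) else 0)
      - color_val (color G ?u) z w * x ?u"
    using i by (simp add: sum_subtractf sum.delta)
  also have "(\<Sum>j<?n. if {?u, vertex_list G ! j} \<in> edges G then x (vertex_list G ! j) else 0)
      = (\<Sum>v\<in>verts G. if {?u, v} \<in> edges G then x v else 0)"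
    by (rule sum.reindex_bij_betw[OF bij])
  also have "\<dots> = sum x (verts G \<inter> neighbours G ?u)"
    unfolding neighbours_def by (simp add: sum.inter_restrict finite_verts)
  also have "verts G \<inter> neighbours G ?u = neighbours G ?u" using neighbours_subset by blast
  finally show "(?A *\<^sub>v vec ?n (\<lambda>j. x (vertex_list G ! j))) $ i
      = vec ?n (\<lambda>i. colored_adjacency_op G z w x (vertex_list G ! i)) $ i"
    using i by (simp add: colored_adjacency_op_def)
qed (use colored_adjacency_mat_carrier[of z w] in simp)

lemma vertex_list_nth:
  assumes "i < card (verts G)"
  shows "vertex_list G ! i \<in> verts G" "vertex_index G (vertex_list G ! i) = i"
proof -
  show v: "vertex_list G ! i \<in> verts G"
    using assms vertex_list(2) length_vertex_list by (metis nth_mem)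
  show "vertex_index G (vertex_list G ! i) = i"
    using vertex_index[OF v] assms vertex_list(1) length_vertex_list
    by (metis nth_eq_iff_index_eq)
qed

text \<open>With \<open>B\<close> the inverse matrix and \<open>e\<close> the unit vector at the
  root, \<open>A x = y e\<close> gives \<open>x = y B e\<close>. At the root this reads
  \<open>1 = y f\<close>, where \<open>f\<close> is the root entry of \<open>B\<close>. Hence any
  solution \<open>x\<close> determines the reciprocal.\<close>

lemma recip_root_fun_eqI:
  assumes zw: "Im z > 0" "Im w > 0"
    and root: "x (root_vertex G) = 1" "colored_adjacency_op G z w x (root_vertex G) = y"
    and other: "\<And>u. u \<in> verts G \<Longrightarrow> u \<noteq> root_vertex G \<Longrightarrow> colored_adjacency_op G z w x u = 0"
  shows "recip_root_fun G z w = y"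
proof -
  let ?n = "card (verts G)" and ?A = "colored_adjacency_mat G z w"
    and ?k = "vertex_index G (root_vertex G)"
  let ?v = "vec ?n (\<lambda>j. x (vertex_list G ! j))"
  note A = colored_adjacency_mat_carrier[of z w] and k = vertex_index[OF root_in_verts]
  obtain B where B: "mat_inverse ?A = Some B" "B \<in> carrier_mat ?n ?n" "B * ?A = 1\<^sub>m ?n"
    using mat_inverse_colored_adjacency_mat[OF zw] by blast
  have "colored_adjacency_op G z w x (vertex_list G ! i) = (if i = ?k then y else 0)"
    if "i < ?n" for i
  proof (cases "i = ?k")
    case True
    then show ?thesis by (simp add: k(2) root(2))
  next
    case False
    then have "vertex_list G ! i \<noteq> root_vertex G" using vertex_list_nth(2)[OF that] by metis
    then show ?thesis using False other[OF vertex_list_nth(1)[OF that]] by simp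
  qed
  then have Av: "?A *\<^sub>v ?v = y \<cdot>\<^sub>v unit_vec ?n ?k"
    unfolding colored_adjacency_mat_mult_vec by (intro eq_vecI) (auto simp: k(1))
  have "?v = (B * ?A) *\<^sub>v ?v" by (simp add: B(3))
  also have "\<dots> = B *\<^sub>v (y \<cdot>\<^sub>v unit_vec ?n ?k)"
    unfolding Av[symmetric] using A B(2) by (intro assoc_mult_mat_vec) auto
  also have "\<dots> = y \<cdot>\<^sub>v col B ?k"
    using B(2) k(1) by (intro eq_vecI) (auto simp: mult_mat_vec)
  finally have "?v $ ?k = (y \<cdot>\<^sub>v col B ?k) $ ?k" by simp
  then have "root_fun G z w * y = 1"
    using B(1,2) k root(1) by (simp add: root_fun_def representing_fun_def mult.commute)
  then show ?thesis
    unfolding recip_root_fun_def by (auto simp: divide_eq_eq mult.commute)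
qed

text \<open>The solution is the root column of the inverse, rescaled to have value 1 at the root;
  this is possible because the root entry is nonzero in the upper half plane.\<close>

lemma recip_root_fun_witness:
  assumes zw: "Im z > 0" "Im w > 0"
  obtains x where "x (root_vertex G) = 1"
    "colored_adjacency_op G z w x (root_vertex G) = recip_root_fun G z w"
    "\<And>u. u \<in> verts G \<Longrightarrow> u \<noteq> root_vertex G \<Longrightarrow> colored_adjacency_op G z w x u = 0"
proof -
  let ?n = "card (verts G)" and ?A = "colored_adjacency_mat G z w"
    and ?k = "vertex_index G (root_vertex G)"
  note A = colored_adjacency_mat_carrier[of z w] and k = vertex_index[OF root_in_verts]
  obtain B where B: "mat_inverse ?A = Some B" "B \<in> carrier_mat ?n ?n" "?A * B = 1\<^sub>m ?n"
    using mat_inverse_colored_adjacency_mat[OF zw] by blast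
  define y where "y = recip_root_fun G z w"
  \<comment> \<open>Outside \<open>verts G\<close> the index is unspecified; these values do not
    matter, since neighbours are always vertices.\<close>
  define x where "x v = y * B $$ (vertex_index G v, ?k)" for v
  let ?v = "vec ?n (\<lambda>j. x (vertex_list G ! j))"
  have "?v = y \<cdot>\<^sub>v col B ?k"
    using B(2) k(1) by (intro eq_vecI) (auto simp: x_def vertex_list_nth)
  then have "?A *\<^sub>v ?v = y \<cdot>\<^sub>v (?A *\<^sub>v col B ?k)"
    using A B(2) k(1) by (simp add: mult_mat_vec)
  also have "?A *\<^sub>v col B ?k = unit_vec ?n ?k"
    using col_mult2[OF A B(2) k(1)] B(3) k(1) by simp
  finally have op: "vec ?n (\<lambda>i. colored_adjacency_op G z w x (vertex_list G ! i))
      = y \<cdot>\<^sub>v unit_vec ?n ?k"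
    unfolding colored_adjacency_mat_mult_vec .
  have op: "colored_adjacency_op G z w x u = (if u = root_vertex G then y else 0)"
    if u: "u \<in> verts G" for u
  proof -
    have "vertex_index G u = ?k \<longleftrightarrow> u = root_vertex G"
      using vertex_index(2)[OF u] k(2) by metis
    then show ?thesis
      using arg_cong[OF op, of "\<lambda>v. v $ vertex_index G u"] vertex_index[OF u] k(1) by simp
  qed
  show thesis
  proof (rule that)
    show "x (root_vertex G) = 1"
      using representing_fun_nonzero[OF zw root_in_verts] B(1)
      by (simp add: x_def y_def recip_root_fun_def root_fun_def representing_fun_def)
  qed (use op root_in_verts in \<open>auto simp: y_def\<close>)
qed

end

text \<open>Without edges only the diagonal term remains, and the constant function 1 is the
  required solution.\<close>

lemma recip_root_fun_single_vertex:
  assumes "Im z > 0" "Im w > 0"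
  shows "recip_root_fun (single_vertex_graph c) z w = - color_val c z w"
  by (rule rooted_colored_graph.recip_root_fun_eqI[where x = "\<lambda>_. 1",
        OF rooted_colored_graph_single_vertex assms])
    (simp_all add: colored_adjacency_op_def neighbours_def single_vertex_graph_def)

section \<open>Gluing the two solutions\<close>

theorem theorem3p1:
  fixes G :: "'a rcgraph" and H :: "'b rcgraph" and a11 :: color and z w :: complex
  assumes "rooted_colored_graph G" and "rooted_colored_graph H"
    and "color G (root_vertex G) = a11" and "color H (root_vertex H) = a11"
    and "Im z > 0" and "Im w > 0"
  shows "recip_root_fun (G \<star> H) z w =
    recip_root_fun G z w + recip_root_fun H z w
      - recip_root_fun (single_vertex_graph a11) z w"
proof -
  interpret G: rooted_colored_graph G by fact
  interpret H: rooted_colored_graph H by fact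
  interpret GH: rooted_colored_graph "G \<star> H" by (rule rooted_colored_graph_star) fact+
  obtain x where x: "x (root_vertex G) = 1"
    "colored_adjacency_op G z w x (root_vertex G) = recip_root_fun G z w"
    "\<And>u. u \<in> verts G \<Longrightarrow> u \<noteq> root_vertex G \<Longrightarrow> colored_adjacency_op G z w x u = 0"
    using G.recip_root_fun_witness[OF assms(5,6)] by blast
  obtain y where y: "y (root_vertex H) = 1"
    "colored_adjacency_op H z w y (root_vertex H) = recip_root_fun H z w"
    "\<And>u. u \<in> verts H \<Longrightarrow> u \<noteq> root_vertex H \<Longrightarrow> colored_adjacency_op H z w y u = 0"
    using H.recip_root_fun_witness[OF assms(5,6)] by blast
  let ?s = "star_inr G H" and ?xy = "case_sum x y"
  have sum_Inl: "sum ?xy (Inl ` N) = sum x N" for N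
    by (simp add: sum.reindex)
  \<comment> \<open>The root of \<open>H\<close> is sent to the left summand, where the glued
    function takes its value from \<open>x\<close>. The common normalization to 1 at the roots makes
    this agree with \<open>y\<close>.\<close>
  have xy_s: "?xy \<circ> ?s = y"
    using x(1) y(1) by (auto simp: star_inr_def)
  have sum_s: "sum ?xy (?s ` N) = sum y N" for N
    by (simp add: sum.reindex[OF inj_on_subset[OF inj_star_inr subset_UNIV]] xy_s)
  \<comment> \<open>The two copies meet only in the identified root, which is not its own neighbour,
    so the neighbour sum at the root splits into two.\<close>
  have disj: "Inl ` neighbours G (root_vertex G) \<inter> ?s ` neighbours H (root_vertex H) = {}"
    using G.not_in_neighbours by (auto simp: star_inr_def split: if_splits)
  show ?thesis
    unfolding recip_root_fun_single_vertex[OF assms(5,6)]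
  proof (rule GH.recip_root_fun_eqI[OF assms(5,6), of ?xy])
    show "?xy (root_vertex (G \<star> H)) = 1"
      by (simp add: root_vertex_star x(1))
    have "sum ?xy (neighbours (G \<star> H) (Inl (root_vertex G)))
        = sum x (neighbours G (root_vertex G)) + sum y (neighbours H (root_vertex H))"
      unfolding neighbours_star_root
      by (subst sum.union_disjoint)
        (simp_all add: G.finite_neighbours H.finite_neighbours disj sum_Inl sum_s)
    \<comment> \<open>Each of the two root values contains the diagonal term
      \<open>- color_val a11 z w\<close>, while the star product contains it once; the summand
      \<open>- - color_val a11 z w\<close> cancels the surplus.\<close>
    then show "colored_adjacency_op (G \<star> H) z w ?xy (root_vertex (G \<star> H))
        = recip_root_fun G z w + recip_root_fun H z w - - color_val a11 z w"
      unfolding x(2)[symmetric] y(2)[symmetric]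
      by (simp add: root_vertex_star colored_adjacency_op_def color_star x(1) y(1) assms(3,4))
  next
    fix u assume u: "u \<in> verts (G \<star> H)" "u \<noteq> root_vertex (G \<star> H)"
    show "colored_adjacency_op (G \<star> H) z w ?xy u = 0"
    proof (cases u)
      case (Inl a)
      \<comment> \<open>A left vertex that comes from \<open>H\<close> can only be the root, which
        is excluded here.\<close>
      then have a: "a \<in> verts G" "a \<noteq> root_vertex G"
        using u by (auto simp: verts_star root_vertex_star star_inr_def split: if_splits)
      then have "colored_adjacency_op (G \<star> H) z w ?xy u = colored_adjacency_op G z w x a"
        by (simp add: Inl colored_adjacency_op_def neighbours_star_Inl sum_Inl color_star)
      then show ?thesis using x(3) a by simp
    next
      case (Inr b)
      \<comment> \<open>\<open>star_inr G H\<close> moves the root of \<open>H\<close> to the left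
        summand, so \<open>b\<close> cannot be that root.\<close>
      then have b: "b \<in> verts H" "b \<noteq> root_vertex H"
        using u by (auto simp: verts_star star_inr_def split: if_splits)
      then have "colored_adjacency_op (G \<star> H) z w ?xy u = colored_adjacency_op H z w y b"
        by (simp add: Inr colored_adjacency_op_def neighbours_star_Inr sum_s color_star)
      then show ?thesis using y(3) b by simp
    qed
  qed
qed

end
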